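(* Let $\mathcal{P}=\{(P_i,[\![-]\!]_i)\}_{i\in\mathcal{I}}$ be a parameterized program and let $\overline{\mathbf{P}}=(\overline{P},\overline{[\![-]\!]})$ be a limit program for $\mathcal{P}$ over a topology $\overline{\mathbb{T}}$. Then $\mathcal{P}$ is safe if and only if $\overline{\mathbf{P}}$ is safe. Furthermore, if $\mathbb{T}$ is a universal structure for $\mathcal{P}$ of which $\overline{\mathbb{T}}$ can be identified with a substructure, then any $\mathbb{T}$-proof space $\mathcal{H}$ proves the safety of $\mathcal{P}$ if and only if it proves the safety of $\overline{\mathbf{P}}$.
   Context: For a structure and a set $V$ of elements, $N(V)$ is the substructure generated by $V$; $N(\vec a)$ that of the entries of tuple $\vec a$; juxtaposition of tuples is concatenation. A local isomorphism from $\vec a$ to $\vec b$ (same length, structures over the same vocabulary) is an isomorphism $\beta:N(\vec a)\to N(\vec b)$ with $\beta(\vec a)=\vec b$; $\vec a\simeq\vec b$ if one exists. An embedding is an injection preserving and reflecting all predicates and functions. Programs. Fix a vocabulary $\mathcal{V}_{\mathsf{Node}}$, a data domain $\mathbb{D}$ (structure over vocabulary $\mathcal{V}_{\mathsf{Data}}$), finite command set $\Sigma$, finite location set $\mathbf{L}$ with distinguished $l_{\mathrm{init}},l_{\mathrm{err}}$, and $\mathsf{src},\mathsf{tgt}:\Sigma\to\mathbf{L}$. A topology is a $\mathcal{V}_{\mathsf{Node}}$-structure. A program over topology $\mathbb{T}'$ is $(P,[\![-]\!])$ with $P:\mathbb{T}'\to2^\Sigma$ and relations $[\![\sigma:v]\!]\subseteq(N(v)\to\mathbb{D})^2$.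 For location maps, $\lambda\xrightarrow{\sigma:v}\lambda'$ iff $\sigma\in P(v)$, $\lambda(v)=\mathsf{src}(\sigma)$ and $\lambda'$ is $\lambda$ with $v$ reassigned to $\mathsf{tgt}(\sigma)$. Error runs $\mathcal{L}_{\mathrm{err}}(P)$: words $\langle\sigma_1:a_1\rangle\cdots\langle\sigma_n:a_n\rangle$ admitting location maps $\lambda_0\equiv l_{\mathrm{init}}$, $\lambda_{r-1}\xrightarrow{\sigma_r:a_r}\lambda_r$ with $l_{\mathrm{err}}$ in the range of $\lambda_n$. For $V\supseteq N(v)$, $\mathsf{Global}_V[\![\sigma:v]\!]$ is the set of pairs of valuations $V\to\mathbb{D}$ whose restrictions to $N(v)$ are in $[\![\sigma:v]\!]$ and which agree outside $N(v)$, extended to words by composition. A run $\rho$ is infeasible if $\mathsf{Global}_{\mathbb{T}'}[\![\rho]\!]=\emptyset$; a program is safe if every error run is infeasible. For a local isomorphism $\beta$, $\beta^*\nu=\nu\circ\beta$ (lifted to pairs and sets). A parameterized program is a family of programs $(P_i,[\![-]\!]_i)$ over topologies $\mathbb{T}_i$ (common $\mathcal{V}_{\mathsf{Node}},\mathbb{D},\Sigma,\mathbf{L}$) such that for $a\in\mathbb{T}_i$, $a'\in\mathbb{T}_j$ and local isomorphism $\beta$ from $a$ to $a'$: $P_i(a)=P_j(a')$ and $[\![\sigma:a]\!]_i=\beta^*[\![\sigma:a']\!]_j$. It is safe if all members are. A universal structure is a $\mathcal{V}_{\mathsf{Node}}$-structure $\mathbb{T}$ into which every $\mathbb{T}_i$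 embeds, each $\mathbb{T}_i$ identified with a substructure of $\mathbb{T}$. Semantics on $\mathbb{T}$: $[\![\sigma:v]\!]=\beta^*[\![\sigma:u]\!]_i$ if some $u\in\mathbb{T}_i$ and local isomorphism $\beta$ from $v$ to $u$ exist, else $\emptyset$. Limits. A $\mathcal{V}_{\mathsf{Node}}$-structure $\overline{\mathbb{T}}$ is a limit of $\{\mathbb{T}_i\}$ if every $\mathbb{T}_i$ embeds into $\overline{\mathbb{T}}$ and every finitely generated substructure of $\overline{\mathbb{T}}$ embeds into some $\mathbb{T}_i$. The limit program over such $\overline{\mathbb{T}}$ is defined by: for $v\in\overline{\mathbb{T}}$, $u\in\mathbb{T}_i$ and a local isomorphism $\beta$ from $v$ to $u$, $\overline{P}(v)=P_i(u)$ and $\overline{[\![\sigma:v]\!]}=\beta^*[\![\sigma:u]\!]_i$ for all $\sigma$. Hoare triples and proof spaces. Assertions: $\phi[\mu(u_1),\dots,\mu(u_m)]$, $\phi$ a $\mathcal{V}_{\mathsf{Data}}$-formula, $u_j\in\mathbb{T}$; $\nu$ satisfies it if $\mathbb{D}\models\phi[\nu(u_1),\dots,\nu(u_m)]$. A triple $\{\phi[\overrightarrow{\mu(u)}]\}\rho\{\psi[\overrightarrow{\mu(w)}]\}$, $\rho=\langle\sigma_1:v_1\rangle\cdots\langle\sigma_n:v_n\rangle$, is valid if for $V=N(\vec u\vec v\vec w)$ every $(\nu,\nu')\in\mathsf{Global}_V[\![\rho]\!]$ with $\nu$ satisfying the precondition has $\nu'$ satisfying the postcondition. Rules (assertions as conjunctions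 of conjuncts): Sequencing — from $\{A_1\}\rho_1\{A_2\}$, $\{A_2'\}\rho_2\{A_3\}$ with each conjunct of $A_2'$ a conjunct of $A_2$, derive $\{A_1\}\rho_1\rho_2\{A_3\}$; Conjunction — from $\{A_1\}\rho\{B_1\}$, $\{A_2\}\rho\{B_2\}$ derive $\{A_1\wedge A_2\}\rho\{B_1\wedge B_2\}$; S-param — from a triple with node tuples $\vec u,\vec v,\vec w$ derive the one with $\vec u',\vec v',\vec w'$ whenever lengths agree and $\vec u\vec v\vec w\simeq\vec u'\vec v'\vec w'$. A $\mathbb{T}$-proof space is a set of triples closed under these rules; valid if all triples are valid; $\mathcal{L}(\mathcal{H})=\{\rho:\{\top\}\rho\{\bot\}\in\mathcal{H}\}$. $\mathcal{H}$ proves the safety of $\mathcal{P}$ if it is valid and $\bigcup_i\mathcal{L}_{\mathrm{err}}(P_i)\subseteq\mathcal{L}(\mathcal{H})$; it proves the safety of $\overline{\mathbf{P}}$ (with $\overline{\mathbb{T}}$ identified with a substructure of $\mathbb{T}$) if it is valid and $\mathcal{L}_{\mathrm{err}}(\overline{P})\subseteq\mathcal{L}(\mathcal{H})$. *)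

theory Defs
  imports Main "HOL-Library.FuncSet"
begin

section \<open>Structures\<close>

record ('f, 'p) vocabulary =
  fun_syms :: "'f set"
  fun_ar :: "'f \<Rightarrow> nat"
  pred_syms :: "'p set"
  pred_ar :: "'p \<Rightarrow> nat"

record ('f, 'p, 'a) struct =
  carrier :: "'a set"
  fn :: "'f \<Rightarrow> 'a list \<Rightarrow> 'a"
  pr :: "'p \<Rightarrow> 'a list \<Rightarrow> bool"

definition structure_over :: "('f, 'p) vocabulary \<Rightarrow> ('f, 'p, 'a) struct \<Rightarrow> bool" where
  "structure_over \<V> A \<longleftrightarrow>
     (\<forall>f \<in> fun_syms \<V>. \<forall>xs \<in> lists (carrier A). length xs = fun_ar \<V> f \<longrightarrow> fn A f xs \<in> carrier A)"

inductive_set gen :: "('f, 'p) vocabulary \<Rightarrow> ('f, 'p, 'a) struct \<Rightarrow> 'a set \<Rightarrow> 'a set"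
  for \<V> :: "('f, 'p) vocabulary" and A :: "('f, 'p, 'a) struct" and X :: "'a set"
where
  base: "x \<in> X \<Longrightarrow> x \<in> gen \<V> A X"
| app: "f \<in> fun_syms \<V> \<Longrightarrow> length xs = fun_ar \<V> f \<Longrightarrow> xs \<in> lists (gen \<V> A X) \<Longrightarrow> fn A f xs \<in> gen \<V> A X"

text \<open>The substructure \<open>N(X)\<close>; its carrier is \<^term>\<open>gen \<V> A X\<close>.\<close>

definition gensub :: "('f, 'p) vocabulary \<Rightarrow> ('f, 'p, 'a) struct \<Rightarrow> 'a set \<Rightarrow> ('f, 'p, 'a) struct" where
  "gensub \<V> A X = A\<lparr>carrier := gen \<V> A X\<rparr>"

definition embedding ::
  "('f, 'p) vocabulary \<Rightarrow> ('f, 'p, 'a) struct \<Rightarrow> ('f, 'p, 'b) struct \<Rightarrow> ('a \<Rightarrow> 'b) \<Rightarrow> bool" where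
  "embedding \<V> A B h \<longleftrightarrow>
     h \<in> carrier A \<rightarrow> carrier B \<and> inj_on h (carrier A) \<and>
     (\<forall>f \<in> fun_syms \<V>. \<forall>xs \<in> lists (carrier A). length xs = fun_ar \<V> f \<longrightarrow>
        h (fn A f xs) = fn B f (map h xs)) \<and>
     (\<forall>p \<in> pred_syms \<V>. \<forall>xs \<in> lists (carrier A). length xs = pred_ar \<V> p \<longrightarrow>
        (pr A p xs \<longleftrightarrow> pr B p (map h xs)))"

definition isomorphism ::
  "('f, 'p) vocabulary \<Rightarrow> ('f, 'p, 'a) struct \<Rightarrow> ('f, 'p, 'b) struct \<Rightarrow> ('a \<Rightarrow> 'b) \<Rightarrow> bool" where
  "isomorphism \<V> A B h \<longleftrightarrow> embedding \<V> A B h \<and> h ` carrier A = carrier B"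

definition local_iso ::
  "('f, 'p) vocabulary \<Rightarrow> ('f, 'p, 'a) struct \<Rightarrow> 'a list \<Rightarrow> ('f, 'p, 'b) struct \<Rightarrow> 'b list \<Rightarrow> ('a \<Rightarrow> 'b) \<Rightarrow> bool"
where
  "local_iso \<V> A as B bs \<beta> \<longleftrightarrow>
     as \<in> lists (carrier A) \<and> bs \<in> lists (carrier B) \<and>
     isomorphism \<V> (gensub \<V> A (set as)) (gensub \<V> B (set bs)) \<beta> \<and> map \<beta> as = bs"

definition locally_isomorphic ::
  "('f, 'p) vocabulary \<Rightarrow> ('f, 'p, 'a) struct \<Rightarrow> 'a list \<Rightarrow> ('f, 'p, 'b) struct \<Rightarrow> 'b list \<Rightarrow> bool" where
  "locally_isomorphic \<V> A as B bs \<longleftrightarrow> (\<exists>\<beta>. local_iso \<V> A as B bs \<beta>)"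


section \<open>Programs\<close>

record ('f, 'p, 'g, 'q, 'd, 'c, 'l) setting =
  node_voc :: "('f, 'p) vocabulary"
  data_voc :: "('g, 'q) vocabulary"
  data :: "('g, 'q, 'd) struct"
  cmds :: "'c set"
  locs :: "'l set"
  l_init :: 'l
  l_err :: 'l
  src :: "'c \<Rightarrow> 'l"
  tgt :: "'c \<Rightarrow> 'l"

definition wf_setting :: "('f, 'p, 'g, 'q, 'd, 'c, 'l) setting \<Rightarrow> bool" where
  "wf_setting S \<longleftrightarrow>
     structure_over (data_voc S) (data S) \<and> finite (cmds S) \<and> finite (locs S) \<and>
     l_init S \<in> locs S \<and> l_err S \<in> locs S \<and>
     src S \<in> cmds S \<rightarrow> locs S \<and> tgt S \<in> cmds S \<rightarrow> locs S"

abbreviation Nd :: "('f, 'p, 'g, 'q, 'd, 'c, 'l) setting \<Rightarrow> ('f, 'p, 't) struct \<Rightarrow> 't set \<Rightarrow> 't set" where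
  "Nd S T X \<equiv> gen (node_voc S) T X"

text \<open>Functions \<open>V \<rightarrow> \<DD>\<close> are represented by extensional functions, so that
  sets of valuations on a given domain do not contain spurious duplicates.\<close>

abbreviation valuations :: "('f, 'p, 'g, 'q, 'd, 'c, 'l) setting \<Rightarrow> 't set \<Rightarrow> ('t \<Rightarrow> 'd) set" where
  "valuations S V \<equiv> V \<rightarrow>\<^sub>E carrier (data S)"

type_synonym ('t, 'd) trel = "(('t \<Rightarrow> 'd) \<times> ('t \<Rightarrow> 'd)) set"

record ('f, 'p, 't, 'c, 'd) prog =
  topo :: "('f, 'p, 't) struct"
  cmd_map :: "'t \<Rightarrow> 'c set"
  sem :: "'c \<Rightarrow> 't \<Rightarrow> ('t, 'd) trel"

definition is_program ::
  "('f, 'p, 'g, 'q, 'd, 'c, 'l) setting \<Rightarrow> ('f, 'p, 't, 'c, 'd) prog \<Rightarrow> bool" where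
  "is_program S P \<longleftrightarrow>
     structure_over (node_voc S) (topo P) \<and>
     (\<forall>v \<in> carrier (topo P). cmd_map P v \<subseteq> cmds S \<and>
        (\<forall>\<sigma> \<in> cmds S. sem P \<sigma> v \<subseteq>
           valuations S (Nd S (topo P) {v}) \<times> valuations S (Nd S (topo P) {v})))"

definition loc_step ::
  "('f, 'p, 'g, 'q, 'd, 'c, 'l) setting \<Rightarrow> ('f, 'p, 't, 'c, 'd) prog \<Rightarrow>
   ('t \<Rightarrow> 'l) \<Rightarrow> 'c \<times> 't \<Rightarrow> ('t \<Rightarrow> 'l) \<Rightarrow> bool" where
  "loc_step S P m0 a m1 \<longleftrightarrow>
     (case a of (\<sigma>, v) \<Rightarrow>
        v \<in> carrier (topo P) \<and> \<sigma> \<in> cmd_map P v \<and> m0 v = src S \<sigma> \<and> m1 = m0(v := tgt S \<sigma>))"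

fun loc_run ::
  "('f, 'p, 'g, 'q, 'd, 'c, 'l) setting \<Rightarrow> ('f, 'p, 't, 'c, 'd) prog \<Rightarrow>
   ('t \<Rightarrow> 'l) \<Rightarrow> ('c \<times> 't) list \<Rightarrow> ('t \<Rightarrow> 'l) \<Rightarrow> bool" where
  "loc_run S P m0 [] m1 \<longleftrightarrow> m1 = m0"
| "loc_run S P m0 (a # \<rho>) m1 \<longleftrightarrow> (\<exists>m'. loc_step S P m0 a m' \<and> loc_run S P m' \<rho> m1)"

definition error_runs ::
  "('f, 'p, 'g, 'q, 'd, 'c, 'l) setting \<Rightarrow> ('f, 'p, 't, 'c, 'd) prog \<Rightarrow> ('c \<times> 't) list set" where
  "error_runs S P =
     {\<rho>. \<exists>m. loc_run S P (\<lambda>v \<in> carrier (topo P). l_init S) \<rho> m \<and> l_err S \<in> m ` carrier (topo P)}"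

definition global_step ::
  "('f, 'p, 'g, 'q, 'd, 'c, 'l) setting \<Rightarrow> ('f, 'p, 't) struct \<Rightarrow> ('c \<Rightarrow> 't \<Rightarrow> ('t, 'd) trel) \<Rightarrow>
   't set \<Rightarrow> 'c \<times> 't \<Rightarrow> ('t, 'd) trel" where
  "global_step S T sm V a =
     (case a of (\<sigma>, v) \<Rightarrow>
        {(\<nu>, \<nu>'). \<nu> \<in> valuations S V \<and> \<nu>' \<in> valuations S V \<and>
           (restrict \<nu> (Nd S T {v}), restrict \<nu>' (Nd S T {v})) \<in> sm \<sigma> v \<and>
           (\<forall>x \<in> V - Nd S T {v}. \<nu> x = \<nu>' x)})"

fun global ::
  "('f, 'p, 'g, 'q, 'd, 'c, 'l) setting \<Rightarrow> ('f, 'p, 't) struct \<Rightarrow> ('c \<Rightarrow> 't \<Rightarrow> ('t, 'd) trel) \<Rightarrow>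
   't set \<Rightarrow> ('c \<times> 't) list \<Rightarrow> ('t, 'd) trel" where
  "global S T sm V [] = Id_on (valuations S V)"
| "global S T sm V (a # \<rho>) = global_step S T sm V a O global S T sm V \<rho>"

definition infeasible ::
  "('f, 'p, 'g, 'q, 'd, 'c, 'l) setting \<Rightarrow> ('f, 'p, 't, 'c, 'd) prog \<Rightarrow> ('c \<times> 't) list \<Rightarrow> bool" where
  "infeasible S P \<rho> \<longleftrightarrow> global S (topo P) (sem P) (carrier (topo P)) \<rho> = {}"

definition safe ::
  "('f, 'p, 'g, 'q, 'd, 'c, 'l) setting \<Rightarrow> ('f, 'p, 't, 'c, 'd) prog \<Rightarrow> bool" where
  "safe S P \<longleftrightarrow> (\<forall>\<rho> \<in> error_runs S P. infeasible S P \<rho>)"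

text \<open>\<open>\<beta>\<^sup>*\<close> on relations, where \<open>X\<close> is the domain of \<open>\<beta>\<close>.\<close>

definition pullback :: "'a set \<Rightarrow> ('a \<Rightarrow> 'b) \<Rightarrow> ('b, 'd) trel \<Rightarrow> ('a, 'd) trel" where
  "pullback X \<beta> R = (\<lambda>(\<nu>, \<nu>'). (compose X \<nu> \<beta>, compose X \<nu>' \<beta>)) ` R"

definition parameterized_program ::
  "('f, 'p, 'g, 'q, 'd, 'c, 'l) setting \<Rightarrow> 'i set \<Rightarrow> ('i \<Rightarrow> ('f, 'p, 't, 'c, 'd) prog) \<Rightarrow> bool" where
  "parameterized_program S I P \<longleftrightarrow>
     (\<forall>i \<in> I. is_program S (P i)) \<and>
     (\<forall>i \<in> I. \<forall>j \<in> I. \<forall>a \<in> carrier (topo (P i)). \<forall>a' \<in> carrier (topo (P j)). \<forall>\<beta>.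
        local_iso (node_voc S) (topo (P i)) [a] (topo (P j)) [a'] \<beta> \<longrightarrow>
          cmd_map (P i) a = cmd_map (P j) a' \<and>
          (\<forall>\<sigma> \<in> cmds S. sem (P i) \<sigma> a = pullback (Nd S (topo (P i)) {a}) \<beta> (sem (P j) \<sigma> a')))"

definition safe_family ::
  "('f, 'p, 'g, 'q, 'd, 'c, 'l) setting \<Rightarrow> 'i set \<Rightarrow> ('i \<Rightarrow> ('f, 'p, 't, 'c, 'd) prog) \<Rightarrow> bool" where
  "safe_family S I P \<longleftrightarrow> (\<forall>i \<in> I. safe S (P i))"


section \<open>Limits and universal structures\<close>

definition is_limit ::
  "('f, 'p) vocabulary \<Rightarrow> 'i set \<Rightarrow> ('i \<Rightarrow> ('f, 'p, 't) struct) \<Rightarrow> ('f, 'p, 's) struct \<Rightarrow> bool" where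
  "is_limit \<V> I Ts TL \<longleftrightarrow>
     structure_over \<V> TL \<and>
     (\<forall>i \<in> I. \<exists>h. embedding \<V> (Ts i) TL h) \<and>
     (\<forall>X. finite X \<and> X \<subseteq> carrier TL \<longrightarrow> (\<exists>i \<in> I. \<exists>h. embedding \<V> (gensub \<V> TL X) (Ts i) h))"

definition limit_program ::
  "('f, 'p, 'g, 'q, 'd, 'c, 'l) setting \<Rightarrow> 'i set \<Rightarrow> ('i \<Rightarrow> ('f, 'p, 't, 'c, 'd) prog) \<Rightarrow>
   ('f, 'p, 's, 'c, 'd) prog \<Rightarrow> bool" where
  "limit_program S I P PL \<longleftrightarrow>
     is_program S PL \<and> is_limit (node_voc S) I (\<lambda>i. topo (P i)) (topo PL) \<and>
     (\<forall>v \<in> carrier (topo PL). \<forall>i \<in> I. \<forall>u \<in> carrier (topo (P i)). \<forall>\<beta>.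
        local_iso (node_voc S) (topo PL) [v] (topo (P i)) [u] \<beta> \<longrightarrow>
          cmd_map PL v = cmd_map (P i) u \<and>
          (\<forall>\<sigma> \<in> cmds S. sem PL \<sigma> v = pullback (Nd S (topo PL) {v}) \<beta> (sem (P i) \<sigma> u)))"

text \<open>The identification of \<open>\<TT>\<^sub>i\<close> with a substructure of \<open>\<TT>\<close> is an explicit embedding \<open>e i\<close>.\<close>

definition universal_structure ::
  "('f, 'p) vocabulary \<Rightarrow> 'i set \<Rightarrow> ('i \<Rightarrow> ('f, 'p, 't) struct) \<Rightarrow> ('f, 'p, 'u) struct \<Rightarrow>
   ('i \<Rightarrow> 't \<Rightarrow> 'u) \<Rightarrow> bool" where
  "universal_structure \<V> I Ts T e \<longleftrightarrow>
     structure_over \<V> T \<and> (\<forall>i \<in> I. embedding \<V> (Ts i) T (e i))"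

definition universal_sem ::
  "('f, 'p, 'g, 'q, 'd, 'c, 'l) setting \<Rightarrow> 'i set \<Rightarrow> ('i \<Rightarrow> ('f, 'p, 't, 'c, 'd) prog) \<Rightarrow>
   ('f, 'p, 'u) struct \<Rightarrow> 'c \<Rightarrow> 'u \<Rightarrow> ('u, 'd) trel" where
  "universal_sem S I P T \<sigma> v =
     (if \<exists>i \<in> I. \<exists>u \<in> carrier (topo (P i)). \<exists>\<beta>. local_iso (node_voc S) T [v] (topo (P i)) [u] \<beta>
      then THE R. \<exists>i \<in> I. \<exists>u \<in> carrier (topo (P i)). \<exists>\<beta>.
             local_iso (node_voc S) T [v] (topo (P i)) [u] \<beta> \<and>
             R = pullback (Nd S T {v}) \<beta> (sem (P i) \<sigma> u)
      else {})"

lemma gensub_simps: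
  "carrier (gensub \<V> A X) = gen \<V> A X" "fn (gensub \<V> A X) = fn A" "pr (gensub \<V> A X) = pr A"
  by (simp_all add: gensub_def)

lemma local_iso_switch:
  assumes b: "local_iso \<V> A as B bs \<beta>" and c: "local_iso \<V> A as C cs \<gamma>"
  shows "local_iso \<V> B bs C cs (\<gamma> \<circ> inv_into (gen \<V> A (set as)) \<beta>)"
proof -
  define X Y Z where "X = gen \<V> A (set as)" and "Y = gen \<V> B (set bs)" and "Z = gen \<V> C (set cs)"
  define \<delta> where "\<delta> = inv_into X \<beta>"
  have bij_b: "inj_on \<beta> X" "\<beta> ` X = Y" and bij_c: "inj_on \<gamma> X" "\<gamma> ` X = Z"
    using b c by (auto simp: local_iso_def isomorphism_def embedding_def gensub_simps X_def Y_def Z_def)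
  have bij_d: "inj_on \<delta> Y" "\<delta> ` Y = X"
    using bij_b inj_on_inv_into[of Y \<beta> X] inv_into_image_cancel[of \<beta> X X] by (auto simp: \<delta>_def)
  have bd: "map \<beta> (map \<delta> ys) = ys" "map \<delta> ys \<in> lists X" if "ys \<in> lists Y" for ys
  proof -
    have "\<beta> (\<delta> y) = y" if "y \<in> Y" for y
      using that bij_b(2) unfolding \<delta>_def by (simp add: f_inv_into_f)
    with that show "map \<beta> (map \<delta> ys) = ys" by (simp add: in_lists_conv_set map_idI)
    show "map \<delta> ys \<in> lists X" using that bij_d(2) by (auto simp: in_lists_conv_set)
  qed
  have inX: "fn A f xs \<in> X" if "f \<in> fun_syms \<V>" "length xs = fun_ar \<V> f" "xs \<in> lists X" for f xs
    using that unfolding X_def by (rule gen.app)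
  have f_b: "\<beta> (fn A f xs) = fn B f (map \<beta> xs)" and f_c: "\<gamma> (fn A f xs) = fn C f (map \<gamma> xs)"
    if "f \<in> fun_syms \<V>" "length xs = fun_ar \<V> f" "xs \<in> lists X" for f xs
    using b c that by (auto simp: local_iso_def isomorphism_def embedding_def gensub_simps X_def)
  have p_b: "pr A p xs = pr B p (map \<beta> xs)" and p_c: "pr A p xs = pr C p (map \<gamma> xs)"
    if "p \<in> pred_syms \<V>" "length xs = pred_ar \<V> p" "xs \<in> lists X" for p xs
    using b c that by (auto simp: local_iso_def isomorphism_def embedding_def gensub_simps X_def)
  have "inj_on (\<gamma> \<circ> \<delta>) Y" "(\<gamma> \<circ> \<delta>) ` Y = Z"
    using bij_d bij_c by (simp_all only: comp_inj_on image_comp[symmetric])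
  moreover have "(\<gamma> \<circ> \<delta>) (fn B f ys) = fn C f (map (\<gamma> \<circ> \<delta>) ys)"
    if "f \<in> fun_syms \<V>" "length ys = fun_ar \<V> f" "ys \<in> lists Y" for f ys
  proof -
    let ?xs = "map \<delta> ys"
    have *: "length ?xs = fun_ar \<V> f" "?xs \<in> lists X" using that bd by auto
    have "fn B f ys = \<beta> (fn A f ?xs)" using f_b[OF that(1) *] bd(1)[OF that(3)] by simp
    then have "\<delta> (fn B f ys) = fn A f ?xs"
      using inX[OF that(1) *] bij_b by (simp add: \<delta>_def)
    then show ?thesis using f_c[OF that(1) *] by simp
  qed
  moreover have "pr B p ys = pr C p (map (\<gamma> \<circ> \<delta>) ys)"
    if "p \<in> pred_syms \<V>" "length ys = pred_ar \<V> p" "ys \<in> lists Y" for p ys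
    using p_b[OF that(1), of "map \<delta> ys"] p_c[OF that(1), of "map \<delta> ys"] bd[OF that(3)] that by simp
  moreover have "map (\<gamma> \<circ> \<delta>) bs = cs"
  proof -
    have "set as \<subseteq> X" by (auto simp: X_def intro: gen.base)
    then have "map \<delta> (map \<beta> as) = as" using bij_b by (auto simp: \<delta>_def intro!: map_idI)
    moreover have "bs = map \<beta> as" "cs = map \<gamma> as" using b c by (auto simp: local_iso_def)
    ultimately show ?thesis by (metis map_map)
  qed
  moreover have "bs \<in> lists (carrier B)" "cs \<in> lists (carrier C)"
    using b c by (auto simp: local_iso_def)
  ultimately have "local_iso \<V> B bs C cs (\<gamma> \<circ> \<delta>)"
    unfolding local_iso_def isomorphism_def embedding_def gensub_simps Y_def[symmetric] Z_def[symmetric]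
    by (intro conjI ballI impI) (assumption | blast)+
  then show ?thesis by (simp only: \<delta>_def X_def)
qed

lemma pullback_pullback:
  assumes "\<beta> ` X \<subseteq> Y" and "\<And>x. x \<in> X \<Longrightarrow> \<epsilon> (\<beta> x) = \<gamma> x"
  shows "pullback X \<beta> (pullback Y \<epsilon> R) = pullback X \<gamma> R"
proof -
  have "compose X (compose Y \<nu> \<epsilon>) \<beta> = compose X \<nu> \<gamma>" for \<nu>
    using assms by (auto simp: compose_def fun_eq_iff)
  then show ?thesis
    unfolding pullback_def image_image by (intro image_cong) auto
qed

text \<open>The definite description in \<open>universal_sem\<close> is well defined: every choice yields the same relation.\<close>

lemma universal_sem_eq:
  assumes P: "parameterized_program S I P" and \<sigma>: "\<sigma> \<in> cmds S"
    and i: "i \<in> I" "u \<in> carrier (topo (P i))" "local_iso (node_voc S) T [v] (topo (P i)) [u] \<beta>"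
  shows "universal_sem S I P T \<sigma> v = pullback (Nd S T {v}) \<beta> (sem (P i) \<sigma> u)"
proof -
  have same: "pullback (Nd S T {v}) \<gamma> (sem (P j) \<sigma> w) = pullback (Nd S T {v}) \<beta> (sem (P i) \<sigma> u)"
    if j: "j \<in> I" "w \<in> carrier (topo (P j))" "local_iso (node_voc S) T [v] (topo (P j)) [w] \<gamma>" for j w \<gamma>
  proof -
    let ?X = "Nd S T {v}" and ?Y = "Nd S (topo (P i)) {u}"
    let ?\<epsilon> = "\<gamma> \<circ> inv_into ?X \<beta>"
    have "local_iso (node_voc S) (topo (P i)) [u] (topo (P j)) [w] ?\<epsilon>"
      using local_iso_switch[OF i(3) j(3)] by simp
    with P \<sigma> i j have *: "sem (P i) \<sigma> u = pullback ?Y ?\<epsilon> (sem (P j) \<sigma> w)"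
      unfolding parameterized_program_def by blast
    have "inj_on \<beta> ?X" "\<beta> ` ?X \<subseteq> ?Y"
      using i(3) by (auto simp: local_iso_def isomorphism_def embedding_def gensub_simps)
    then show ?thesis
      unfolding * by (subst pullback_pullback[where \<gamma> = \<gamma>]) auto
  qed
  have ex: "\<exists>i \<in> I. \<exists>u \<in> carrier (topo (P i)). \<exists>\<beta>. local_iso (node_voc S) T [v] (topo (P i)) [u] \<beta>"
    using i by blast
  show ?thesis
    unfolding universal_sem_def if_P[OF ex]
  proof (rule the_equality, goal_cases)
    case 1
    show ?case using i by blast
  next
    case (2 R)
    then show ?case using same by blast
  qed
qed


section \<open>Assertions, Hoare triples and proof spaces\<close>

text \<open>First-order terms and formulas with equality. Quantified variables are de Bruijn
  indices; free variables are parameters taken from the type \<^typ>\<open>'x\<close>.\<close>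

datatype (dead 'g, tm_params: 'x) tm =
    Bnd nat
  | Par 'x
  | Fn 'g "('g, 'x) tm list"

datatype (dead 'g, dead 'q, fm_params: 'x) fm =
    Top
  | Bot
  | Eq "('g, 'x) tm" "('g, 'x) tm"
  | Pr 'q "('g, 'x) tm list"
  | Neg "('g, 'q, 'x) fm"
  | And "('g, 'q, 'x) fm" "('g, 'q, 'x) fm"
  | Or "('g, 'q, 'x) fm" "('g, 'q, 'x) fm"
  | Imp "('g, 'q, 'x) fm" "('g, 'q, 'x) fm"
  | Forall "('g, 'q, 'x) fm"
  | Exists "('g, 'q, 'x) fm"

primrec wf_tm :: "('g, 'q) vocabulary \<Rightarrow> nat \<Rightarrow> ('g, 'x) tm \<Rightarrow> bool" where
  "wf_tm \<V> k (Bnd n) \<longleftrightarrow> n < k"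
| "wf_tm \<V> k (Par x) \<longleftrightarrow> True"
| "wf_tm \<V> k (Fn f ts) \<longleftrightarrow> f \<in> fun_syms \<V> \<and> length ts = fun_ar \<V> f \<and> list_all (wf_tm \<V> k) ts"

primrec wf_fm :: "('g, 'q) vocabulary \<Rightarrow> nat \<Rightarrow> ('g, 'q, 'x) fm \<Rightarrow> bool" where
  "wf_fm \<V> k Top \<longleftrightarrow> True"
| "wf_fm \<V> k Bot \<longleftrightarrow> True"
| "wf_fm \<V> k (Eq s t) \<longleftrightarrow> wf_tm \<V> k s \<and> wf_tm \<V> k t"
| "wf_fm \<V> k (Pr p ts) \<longleftrightarrow> p \<in> pred_syms \<V> \<and> length ts = pred_ar \<V> p \<and> list_all (wf_tm \<V> k) ts"
| "wf_fm \<V> k (Neg \<phi>) \<longleftrightarrow> wf_fm \<V> k \<phi>"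
| "wf_fm \<V> k (And \<phi> \<psi>) \<longleftrightarrow> wf_fm \<V> k \<phi> \<and> wf_fm \<V> k \<psi>"
| "wf_fm \<V> k (Or \<phi> \<psi>) \<longleftrightarrow> wf_fm \<V> k \<phi> \<and> wf_fm \<V> k \<psi>"
| "wf_fm \<V> k (Imp \<phi> \<psi>) \<longleftrightarrow> wf_fm \<V> k \<phi> \<and> wf_fm \<V> k \<psi>"
| "wf_fm \<V> k (Forall \<phi>) \<longleftrightarrow> wf_fm \<V> (Suc k) \<phi>"
| "wf_fm \<V> k (Exists \<phi>) \<longleftrightarrow> wf_fm \<V> (Suc k) \<phi>"

primrec tm_val :: "('g, 'q, 'd) struct \<Rightarrow> ('x \<Rightarrow> 'd) \<Rightarrow> 'd list \<Rightarrow> ('g, 'x) tm \<Rightarrow> 'd" where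
  "tm_val D \<nu> ds (Bnd n) = ds ! n"
| "tm_val D \<nu> ds (Par x) = \<nu> x"
| "tm_val D \<nu> ds (Fn f ts) = fn D f (map (tm_val D \<nu> ds) ts)"

primrec sat :: "('g, 'q, 'd) struct \<Rightarrow> ('x \<Rightarrow> 'd) \<Rightarrow> 'd list \<Rightarrow> ('g, 'q, 'x) fm \<Rightarrow> bool" where
  "sat D \<nu> ds Top \<longleftrightarrow> True"
| "sat D \<nu> ds Bot \<longleftrightarrow> False"
| "sat D \<nu> ds (Eq s t) \<longleftrightarrow> tm_val D \<nu> ds s = tm_val D \<nu> ds t"
| "sat D \<nu> ds (Pr p ts) \<longleftrightarrow> pr D p (map (tm_val D \<nu> ds) ts)"
| "sat D \<nu> ds (Neg \<phi>) \<longleftrightarrow> \<not> sat D \<nu> ds \<phi>"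
| "sat D \<nu> ds (And \<phi> \<psi>) \<longleftrightarrow> sat D \<nu> ds \<phi> \<and> sat D \<nu> ds \<psi>"
| "sat D \<nu> ds (Or \<phi> \<psi>) \<longleftrightarrow> sat D \<nu> ds \<phi> \<or> sat D \<nu> ds \<psi>"
| "sat D \<nu> ds (Imp \<phi> \<psi>) \<longleftrightarrow> (sat D \<nu> ds \<phi> \<longrightarrow> sat D \<nu> ds \<psi>)"
| "sat D \<nu> ds (Forall \<phi>) \<longleftrightarrow> (\<forall>d \<in> carrier D. sat D \<nu> (d # ds) \<phi>)"
| "sat D \<nu> ds (Exists \<phi>) \<longleftrightarrow> (\<exists>d \<in> carrier D. sat D \<nu> (d # ds) \<phi>)"

text \<open>A data formula \<open>\<phi>\<close> with free variables \<open>x\<^sub>0, \<dots>, x\<^sub>m\<^sub>-\<^sub>1\<close> has type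
  \<^typ>\<open>('g, 'q, nat) fm\<close>. The assertion \<open>\<phi>[\<mu>(u\<^sub>0), \<dots>, \<mu>(u\<^sub>m\<^sub>-\<^sub>1)]\<close> is the formula over nodes in
  which \<open>x\<^sub>j\<close> is replaced by the parameter \<open>u\<^sub>j\<close>, read as \<open>\<mu>(u\<^sub>j)\<close>.\<close>

definition data_formula :: "('g, 'q) vocabulary \<Rightarrow> nat \<Rightarrow> ('g, 'q, nat) fm \<Rightarrow> bool" where
  "data_formula \<V> m \<phi> \<longleftrightarrow> wf_fm \<V> 0 \<phi> \<and> fm_params \<phi> \<subseteq> {..<m}"

definition inst :: "('g, 'q, nat) fm \<Rightarrow> 'u list \<Rightarrow> ('g, 'q, 'u) fm" where
  "inst \<phi> us = map_fm (\<lambda>j. us ! j) \<phi>"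

definition assertions ::
  "('f, 'p, 'g, 'q, 'd, 'c, 'l) setting \<Rightarrow> ('f, 'p, 'u) struct \<Rightarrow> ('g, 'q, 'u) fm set" where
  "assertions S T =
     {inst \<phi> us | \<phi> us. us \<in> lists (carrier T) \<and> data_formula (data_voc S) (length us) \<phi>}"

text \<open>Conjunction is kept syntactic; in particular \<^const>\<open>Top\<close> is its own only conjunct
  rather than the empty conjunction.\<close>

fun conjuncts :: "('g, 'q, 'u) fm \<Rightarrow> ('g, 'q, 'u) fm set" where
  "conjuncts (And \<phi> \<psi>) = conjuncts \<phi> \<union> conjuncts \<psi>"
| "conjuncts \<phi> = {\<phi>}"

type_synonym ('g, 'q, 'u, 'c) triple = "('g, 'q, 'u) fm \<times> ('c \<times> 'u) list \<times> ('g, 'q, 'u) fm"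

definition triples ::
  "('f, 'p, 'g, 'q, 'd, 'c, 'l) setting \<Rightarrow> ('f, 'p, 'u) struct \<Rightarrow> ('g, 'q, 'u, 'c) triple set" where
  "triples S T = assertions S T \<times> lists (cmds S \<times> carrier T) \<times> assertions S T"

definition valid_triple ::
  "('f, 'p, 'g, 'q, 'd, 'c, 'l) setting \<Rightarrow> 'i set \<Rightarrow> ('i \<Rightarrow> ('f, 'p, 't, 'c, 'd) prog) \<Rightarrow>
   ('f, 'p, 'u) struct \<Rightarrow> ('g, 'q, 'u, 'c) triple \<Rightarrow> bool" where
  "valid_triple S I P T \<tau> \<longleftrightarrow>
     (case \<tau> of (A, \<rho>, B) \<Rightarrow>
        \<forall>(\<nu>, \<nu>') \<in> global S T (universal_sem S I P T)
                     (Nd S T (fm_params A \<union> snd ` set \<rho> \<union> fm_params B)) \<rho>.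
          sat (data S) \<nu> [] A \<longrightarrow> sat (data S) \<nu>' [] B)"

definition sequencing_closed :: "('g, 'q, 'u, 'c) triple set \<Rightarrow> bool" where
  "sequencing_closed H \<longleftrightarrow>
     (\<forall>A1 \<rho>1 A2 A2' \<rho>2 A3.
        (A1, \<rho>1, A2) \<in> H \<and> (A2', \<rho>2, A3) \<in> H \<and> conjuncts A2' \<subseteq> conjuncts A2 \<longrightarrow>
        (A1, \<rho>1 @ \<rho>2, A3) \<in> H)"

definition conjunction_closed :: "('g, 'q, 'u, 'c) triple set \<Rightarrow> bool" where
  "conjunction_closed H \<longleftrightarrow>
     (\<forall>A1 B1 A2 B2 \<rho>. (A1, \<rho>, B1) \<in> H \<and> (A2, \<rho>, B2) \<in> H \<longrightarrow> (And A1 A2, \<rho>, And B1 B2) \<in> H)"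

definition s_param_closed ::
  "('f, 'p, 'g, 'q, 'd, 'c, 'l) setting \<Rightarrow> ('f, 'p, 'u) struct \<Rightarrow> ('g, 'q, 'u, 'c) triple set \<Rightarrow> bool" where
  "s_param_closed S T H \<longleftrightarrow>
     (\<forall>\<phi> \<psi> \<sigma>s us vs ws us' vs' ws'.
        data_formula (data_voc S) (length us) \<phi> \<and> data_formula (data_voc S) (length ws) \<psi> \<and>
        length \<sigma>s = length vs \<and>
        length us' = length us \<and> length vs' = length vs \<and> length ws' = length ws \<and>
        locally_isomorphic (node_voc S) T (us @ vs @ ws) T (us' @ vs' @ ws') \<and>
        (inst \<phi> us, zip \<sigma>s vs, inst \<psi> ws) \<in> H \<longrightarrow>
        (inst \<phi> us', zip \<sigma>s vs', inst \<psi> ws') \<in> H)"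

definition proof_space ::
  "('f, 'p, 'g, 'q, 'd, 'c, 'l) setting \<Rightarrow> ('f, 'p, 'u) struct \<Rightarrow> ('g, 'q, 'u, 'c) triple set \<Rightarrow> bool" where
  "proof_space S T H \<longleftrightarrow>
     H \<subseteq> triples S T \<and> sequencing_closed H \<and> conjunction_closed H \<and> s_param_closed S T H"

definition valid_space ::
  "('f, 'p, 'g, 'q, 'd, 'c, 'l) setting \<Rightarrow> 'i set \<Rightarrow> ('i \<Rightarrow> ('f, 'p, 't, 'c, 'd) prog) \<Rightarrow>
   ('f, 'p, 'u) struct \<Rightarrow> ('g, 'q, 'u, 'c) triple set \<Rightarrow> bool" where
  "valid_space S I P T H \<longleftrightarrow> (\<forall>\<tau> \<in> H. valid_triple S I P T \<tau>)"

definition lang :: "('g, 'q, 'u, 'c) triple set \<Rightarrow> ('c \<times> 'u) list set" where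
  "lang H = {\<rho>. (Top, \<rho>, Bot) \<in> H}"

definition embed_run :: "('t \<Rightarrow> 'u) \<Rightarrow> ('c \<times> 't) list \<Rightarrow> ('c \<times> 'u) list" where
  "embed_run h \<rho> = map (\<lambda>(\<sigma>, v). (\<sigma>, h v)) \<rho>"

definition proves_family ::
  "('f, 'p, 'g, 'q, 'd, 'c, 'l) setting \<Rightarrow> 'i set \<Rightarrow> ('i \<Rightarrow> ('f, 'p, 't, 'c, 'd) prog) \<Rightarrow>
   ('f, 'p, 'u) struct \<Rightarrow> ('i \<Rightarrow> 't \<Rightarrow> 'u) \<Rightarrow> ('g, 'q, 'u, 'c) triple set \<Rightarrow> bool" where
  "proves_family S I P T e H \<longleftrightarrow>
     valid_space S I P T H \<and> (\<Union>i \<in> I. embed_run (e i) ` error_runs S (P i)) \<subseteq> lang H"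

definition proves_limit ::
  "('f, 'p, 'g, 'q, 'd, 'c, 'l) setting \<Rightarrow> 'i set \<Rightarrow> ('i \<Rightarrow> ('f, 'p, 't, 'c, 'd) prog) \<Rightarrow>
   ('f, 'p, 'u) struct \<Rightarrow> ('f, 'p, 's, 'c, 'd) prog \<Rightarrow> ('s \<Rightarrow> 'u) \<Rightarrow>
   ('g, 'q, 'u, 'c) triple set \<Rightarrow> bool" where
  "proves_limit S I P T PL eL H \<longleftrightarrow>
     valid_space S I P T H \<and> embed_run eL ` error_runs S PL \<subseteq> lang H"

end

theory Submission
  imports Defs
begin

text \<open>An error run involves finitely many nodes: those it schedules, together with one node
  that ends up in the error location. The substructure of the limit generated by these nodes embeds
  into some member of the family, and every member embeds into the limit. All these embeddings
  preserve commands and semantics, so they preserve and reflect error runs and feasibility: a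
  valuation of the larger topology restricts along the embedding, and a valuation of the smaller
  one extends arbitrarily, nodes outside the image being left unchanged by the run.
  For proof spaces, the images of a run under two embeddings into the universal structure visit
  locally isomorphic tuples of nodes, so the S-param rule transports the triple with precondition
  \<open>\<top>\<close> and postcondition \<open>\<bottom>\<close> from one to the other.\<close>

section \<open>Generated substructures and embeddings\<close>

lemma gen_subset_carrier:
  assumes "structure_over \<V> A" and "X \<subseteq> carrier A"
  shows "gen \<V> A X \<subseteq> carrier A"
proof
  fix x assume "x \<in> gen \<V> A X"
  then show "x \<in> carrier A"
  proof induction
    case (base x)
    then show ?case using assms(2) by blast
  next
    case (app f xs)
    then have "xs \<in> lists (carrier A)" by (auto simp: in_lists_conv_set)
    with app assms(1) show ?case by (auto simp: structure_over_def)
  qed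
qed

lemma gen_cong:
  fixes A B :: "('f, 'p, 'a) struct"
  assumes "fn A = fn B"
  shows "gen \<V> A X = gen \<V> B X"
proof -
  have "x \<in> gen \<V> B X" if "x \<in> gen \<V> A X" "fn A = fn B" for x and A B :: "('f, 'p, 'a) struct"
    using that by induction (auto simp: in_lists_conv_set intro: gen.base intro!: gen.app)
  from this[of _ A B] this[of _ B A] assms show ?thesis by auto
qed

lemma gen_gensub [simp]: "gen \<V> (gensub \<V>' A Y) X = gen \<V> A X"
  by (rule gen_cong) (simp add: gensub_simps)

lemma structure_over_gensub: "structure_over \<V> (gensub \<V> A X)"
  by (auto simp: structure_over_def gensub_simps intro: gen.app)

lemma embedding_comp:
  assumes "embedding \<V> A B g" and "embedding \<V> B C h"
  shows "embedding \<V> A C (h \<circ> g)"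
proof -
  have g: "g \<in> carrier A \<rightarrow> carrier B" "inj_on g (carrier A)"
    using assms(1) by (auto simp: embedding_def)
  have h: "h \<in> carrier B \<rightarrow> carrier C" "inj_on h (carrier B)"
    using assms(2) by (auto simp: embedding_def)
  have "map g xs \<in> lists (carrier B)" if "xs \<in> lists (carrier A)" for xs
    using that g(1) by (auto simp: in_lists_conv_set)
  moreover have "inj_on (h \<circ> g) (carrier A)"
    using g h by (auto simp: inj_on_def Pi_iff)
  ultimately show ?thesis
    using assms g(1) h(1) by (auto simp: embedding_def Pi_iff)
qed

lemma embedding_restrict:
  assumes "embedding \<V> A B h" and "gen \<V> A X \<subseteq> carrier A"
  shows "embedding \<V> (gensub \<V> A X) B h"
proof -
  have "xs \<in> lists (carrier A)" if "xs \<in> lists (gen \<V> A X)" for xs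
    using that assms(2) by (auto simp: in_lists_conv_set)
  with assms show ?thesis
    by (auto simp: embedding_def gensub_simps Pi_iff intro: inj_on_subset)
qed

lemma embedding_id: "embedding \<V> A A id"
  by (simp add: embedding_def)

text \<open>An embedding commutes with the functions, so elements on both sides are built by
  matching applications. Each inclusion is an induction on generation; for the first, an argument
  list in the image is lifted to a list of preimages.\<close>

lemma gen_image:
  assumes A: "structure_over \<V> A" and h: "embedding \<V> A B h" and X: "X \<subseteq> carrier A"
  shows "gen \<V> B (h ` X) = h ` gen \<V> A X"
proof
  note sub = gen_subset_carrier[OF A X]
  have fn_h: "h (fn A f xs) = fn B f (map h xs)"
    if "f \<in> fun_syms \<V>" "length xs = fun_ar \<V> f" "xs \<in> lists (gen \<V> A X)" for f xs
  proof -
    have "xs \<in> lists (carrier A)" using that sub by (auto simp: in_lists_conv_set)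
    with that h show ?thesis by (auto simp: embedding_def)
  qed
  show "gen \<V> B (h ` X) \<subseteq> h ` gen \<V> A X"
  proof
    fix y assume "y \<in> gen \<V> B (h ` X)"
    then show "y \<in> h ` gen \<V> A X"
    proof induction
      case (base y)
      then show ?case by (auto intro: gen.base)
    next
      case (app f ys)
      then have "ys \<in> lists (h ` gen \<V> A X)" by (auto simp: in_lists_conv_set)
      then obtain xs where xs: "xs \<in> lists (gen \<V> A X)" "ys = map h xs"
        by (auto simp: lists_image)
      with app have "fn A f xs \<in> gen \<V> A X" "fn B f ys = h (fn A f xs)"
        by (auto simp: fn_h intro: gen.app)
      then show ?case by blast
    qed
  qed
  show "h ` gen \<V> A X \<subseteq> gen \<V> B (h ` X)"
  proof
    fix y assume "y \<in> h ` gen \<V> A X"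
    then obtain x where "x \<in> gen \<V> A X" "y = h x" by blast
    then show "y \<in> gen \<V> B (h ` X)"
    proof (induction arbitrary: y)
      case (base x)
      then show ?case by (auto intro: gen.base)
    next
      case (app f xs)
      then have xs: "xs \<in> lists (gen \<V> A X)" "map h xs \<in> lists (gen \<V> B (h ` X))"
        by (auto simp: in_lists_conv_set)
      have "y = fn B f (map h xs)" using app fn_h xs by simp
      with gen.app[of f \<V> "map h xs" B "h ` X"] app xs show ?case by simp
    qed
  qed
qed

text \<open>The source of the local isomorphisms used below: by \<open>gen_image\<close>,
  \<open>h\<close> maps the substructure generated by a tuple onto the one generated by its
  image.\<close>

lemma embedding_imp_local_iso:
  assumes A: "structure_over \<V> A" and h: "embedding \<V> A B h" and as: "set as \<subseteq> carrier A"
  shows "local_iso \<V> A as B (map h as) h"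
proof -
  note sub = gen_subset_carrier[OF A as]
  have img: "gen \<V> B (h ` set as) = h ` gen \<V> A (set as)"
    by (rule gen_image[OF A h as])
  have "embedding \<V> (gensub \<V> A (set as)) B h"
    by (rule embedding_restrict[OF h sub])
  then have "isomorphism \<V> (gensub \<V> A (set as)) (gensub \<V> B (set (map h as))) h"
    using img by (auto simp: isomorphism_def embedding_def gensub_simps)
  moreover have "h \<in> carrier A \<rightarrow> carrier B" using h by (simp add: embedding_def)
  ultimately show ?thesis
    using as by (auto simp: local_iso_def in_lists_conv_set)
qed

section \<open>Embeddings of programs\<close>

text \<open>Serves three cases: a member in the limit, a generated part of the limit in the limit,
  and such a part in a member. Relations are compared by pulling back from \<open>Q\<close>, the
  direction in which valuations restrict. That \<open>Q\<close> is a program confines its relations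
  to extensional valuations, which are recovered from their pullbacks.\<close>

definition program_embedding ::
  "('f, 'p, 'g, 'q, 'd, 'c, 'l) setting \<Rightarrow> ('f, 'p, 'a, 'c, 'd) prog \<Rightarrow>
   ('f, 'p, 'b, 'c, 'd) prog \<Rightarrow> ('a \<Rightarrow> 'b) \<Rightarrow> bool" where
  "program_embedding S P Q h \<longleftrightarrow>
     structure_over (node_voc S) (topo P) \<and> is_program S Q \<and>
     embedding (node_voc S) (topo P) (topo Q) h \<and>
     (\<forall>v \<in> carrier (topo P). cmd_map Q (h v) = cmd_map P v \<and>
        (\<forall>\<sigma> \<in> cmds S. sem P \<sigma> v = pullback (Nd S (topo P) {v}) h (sem Q \<sigma> (h v))))"

lemma embed_run_simps [simp]:
  "embed_run h [] = []" "embed_run h ((\<sigma>, v) # \<rho>) = (\<sigma>, h v) # embed_run h \<rho>"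
  by (simp_all add: embed_run_def)

lemma loc_run_nodes:
  assumes "loc_run S P m \<rho> m'"
  shows "snd ` set \<rho> \<subseteq> carrier (topo P)"
  using assms by (induction \<rho> arbitrary: m) (auto simp: loc_step_def)

lemma loc_run_cmds:
  assumes "is_program S P" and "loc_run S P m \<rho> m'"
  shows "fst ` set \<rho> \<subseteq> cmds S"
  using assms(2)
proof (induction \<rho> arbitrary: m)
  case (Cons a \<rho>)
  then show ?case using assms(1) by (cases a) (fastforce simp: loc_step_def is_program_def)
qed simp

lemma global_domain:
  assumes "(\<nu>, \<nu>') \<in> global S T sm V \<rho>"
  shows "\<nu> \<in> valuations S V"
  using assms by (cases \<rho>) (auto simp: global_step_def split: prod.splits)

context
  fixes S :: "('f, 'p, 'g, 'q, 'd, 'c, 'l) setting"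
    and P :: "('f, 'p, 'a, 'c, 'd) prog" and Q :: "('f, 'p, 'b, 'c, 'd) prog"
    and h :: "'a \<Rightarrow> 'b"
  assumes PQ: "program_embedding S P Q h"
begin

lemma program_embedding_carrier: "x \<in> carrier (topo P) \<Longrightarrow> h x \<in> carrier (topo Q)"
  using PQ by (auto simp: program_embedding_def embedding_def)

lemma program_embedding_inj: "inj_on h (carrier (topo P))"
  using PQ by (simp add: program_embedding_def embedding_def)

lemma program_embedding_Nd:
  "v \<in> carrier (topo P) \<Longrightarrow> Nd S (topo Q) {h v} = h ` Nd S (topo P) {v}"
  using gen_image[of "node_voc S" "topo P" "topo Q" h "{v}"] PQ
  by (simp add: program_embedding_def)

lemma program_embedding_Nd_subset:
  "v \<in> carrier (topo P) \<Longrightarrow> Nd S (topo P) {v} \<subseteq> carrier (topo P)"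
  using gen_subset_carrier[of "node_voc S" "topo P" "{v}"] PQ
  by (simp add: program_embedding_def)

section \<open>Transport of error runs along an embedding\<close>

lemma loc_run_embed:
  assumes "loc_run S P m0 \<rho> m" and "\<forall>x \<in> carrier (topo P). n0 (h x) = m0 x"
  shows "\<exists>n. loc_run S Q n0 (embed_run h \<rho>) n \<and> (\<forall>x \<in> carrier (topo P). n (h x) = m x)"
  using assms
proof (induction \<rho> arbitrary: m0 n0)
  case (Cons a \<rho>)
  obtain \<sigma> v where a: "a = (\<sigma>, v)" by force
  from Cons.prems a have v: "v \<in> carrier (topo P)" "\<sigma> \<in> cmd_map P v" "m0 v = src S \<sigma>"
    and run: "loc_run S P (m0(v := tgt S \<sigma>)) \<rho> m"
    by (auto simp: loc_step_def)
  \<comment> \<open>Injectivity makes the update at \<open>h v\<close> visible at \<open>v\<close>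
    only; locations outside the image of \<open>h\<close> are left free by the invariant.\<close>
  have "\<forall>x \<in> carrier (topo P). (n0(h v := tgt S \<sigma>)) (h x) = (m0(v := tgt S \<sigma>)) x"
    using Cons.prems(2) v(1) program_embedding_inj by (auto simp: inj_on_def)
  from Cons.IH[OF run this] obtain n where
    n: "loc_run S Q (n0(h v := tgt S \<sigma>)) (embed_run h \<rho>) n" "\<forall>x \<in> carrier (topo P). n (h x) = m x"
    by blast
  have "loc_step S Q n0 (\<sigma>, h v) (n0(h v := tgt S \<sigma>))"
    using v Cons.prems(2) PQ program_embedding_carrier
    by (simp add: loc_step_def program_embedding_def)
  with n a show ?case by auto
qed simp

lemma loc_run_reflect:
  assumes "loc_run S Q n0 (embed_run h \<rho>) n" and "snd ` set \<rho> \<subseteq> carrier (topo P)"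
    and "\<forall>x \<in> carrier (topo P). n0 (h x) = m0 x"
  shows "\<exists>m. loc_run S P m0 \<rho> m \<and> (\<forall>x \<in> carrier (topo P). n (h x) = m x)"
  using assms
proof (induction \<rho> arbitrary: m0 n0)
  case (Cons a \<rho>)
  obtain \<sigma> v where a: "a = (\<sigma>, v)" by force
  from Cons.prems a have v: "v \<in> carrier (topo P)" "\<sigma> \<in> cmd_map Q (h v)" "n0 (h v) = src S \<sigma>"
    and run: "loc_run S Q (n0(h v := tgt S \<sigma>)) (embed_run h \<rho>) n"
    by (auto simp: loc_step_def)
  have "snd ` set \<rho> \<subseteq> carrier (topo P)" using Cons.prems(2) by auto
  moreover have "\<forall>x \<in> carrier (topo P). (n0(h v := tgt S \<sigma>)) (h x) = (m0(v := tgt S \<sigma>)) x"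
    using Cons.prems(3) v(1) program_embedding_inj by (auto simp: inj_on_def)
  ultimately obtain m where
    m: "loc_run S P (m0(v := tgt S \<sigma>)) \<rho> m" "\<forall>x \<in> carrier (topo P). n (h x) = m x"
    using Cons.IH[OF run] by blast
  have "loc_step S P m0 (\<sigma>, v) (m0(v := tgt S \<sigma>))"
    using v Cons.prems(3) PQ by (simp add: loc_step_def program_embedding_def)
  with m a show ?case by auto
qed simp

lemma error_runs_embed:
  assumes "\<rho> \<in> error_runs S P"
  shows "embed_run h \<rho> \<in> error_runs S Q"
proof -
  obtain m w where m: "loc_run S P (\<lambda>v \<in> carrier (topo P). l_init S) \<rho> m"
    and w: "w \<in> carrier (topo P)" "m w = l_err S"
    using assms by (auto simp: error_runs_def image_iff)
  obtain n where "loc_run S Q (\<lambda>v \<in> carrier (topo Q). l_init S) (embed_run h \<rho>) n"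
    "\<forall>x \<in> carrier (topo P). n (h x) = m x"
    using loc_run_embed[OF m, of "\<lambda>v \<in> carrier (topo Q). l_init S"] program_embedding_carrier
    by auto
  with w program_embedding_carrier[OF w(1)] show ?thesis
    by (auto simp: error_runs_def image_iff intro!: exI[of _ n] bexI[of _ "h w"])
qed

text \<open>Location maps are compared only on the image of \<open>h\<close>, so besides the
  scheduled nodes the node \<open>w\<close> witnessing the error must come from
  \<open>P\<close>.\<close>

lemma error_runs_reflect:
  assumes "loc_run S Q (\<lambda>v \<in> carrier (topo Q). l_init S) (embed_run h \<rho>) n"
    and "snd ` set \<rho> \<subseteq> carrier (topo P)" and "w \<in> carrier (topo P)" and "n (h w) = l_err S"
  shows "\<rho> \<in> error_runs S P"
proof -
  obtain m where "loc_run S P (\<lambda>v \<in> carrier (topo P). l_init S) \<rho> m"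
    "\<forall>x \<in> carrier (topo P). n (h x) = m x"
    using loc_run_reflect[OF assms(1,2), of "\<lambda>v \<in> carrier (topo P). l_init S"]
      program_embedding_carrier by auto
  with assms(3,4) show ?thesis
    by (auto simp: error_runs_def image_iff intro!: exI[of _ m] bexI[of _ w])
qed

section \<open>Transport of feasibility along an embedding\<close>

lemma global_step_restrict:
  assumes v: "v \<in> carrier (topo P)" "\<sigma> \<in> cmds S"
    and step: "(\<mu>, \<mu>') \<in> global_step S (topo Q) (sem Q) (carrier (topo Q)) (\<sigma>, h v)"
  shows "(compose (carrier (topo P)) \<mu> h, compose (carrier (topo P)) \<mu>' h)
    \<in> global_step S (topo P) (sem P) (carrier (topo P)) (\<sigma>, v)"
proof -
  let ?C = "carrier (topo P)" and ?N = "Nd S (topo P) {v}" and ?M = "Nd S (topo Q) {h v}"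
  note M = program_embedding_Nd[OF v(1)] and N = program_embedding_Nd_subset[OF v(1)]
  from step have \<mu>: "\<mu> \<in> valuations S (carrier (topo Q))" "\<mu>' \<in> valuations S (carrier (topo Q))"
    and s: "(restrict \<mu> ?M, restrict \<mu>' ?M) \<in> sem Q \<sigma> (h v)"
    and out: "\<forall>y \<in> carrier (topo Q) - ?M. \<mu> y = \<mu>' y"
    by (auto simp: global_step_def)
  have val: "compose ?C \<xi> h \<in> valuations S ?C" if "\<xi> \<in> valuations S (carrier (topo Q))" for \<xi>
    using that program_embedding_carrier by (auto simp: compose_def)
  \<comment> \<open>Links the two localisations: the step of \<open>Q\<close> reads valuations on
    \<open>?M\<close>, that of \<open>P\<close> on \<open>?N\<close>, and \<open>h\<close> carries
    \<open>?N\<close> into \<open>?M\<close>.\<close>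
  have res: "compose ?N (restrict \<xi> ?M) h = restrict (compose ?C \<xi> h) ?N" for \<xi>
    unfolding M using N by (auto simp: compose_def fun_eq_iff)
  have "(restrict (compose ?C \<mu> h) ?N, restrict (compose ?C \<mu>' h) ?N)
      \<in> pullback ?N h (sem Q \<sigma> (h v))"
    unfolding pullback_def by (rule image_eqI[OF _ s]) (simp add: res)
  then have "(restrict (compose ?C \<mu> h) ?N, restrict (compose ?C \<mu>' h) ?N) \<in> sem P \<sigma> v"
    using PQ v by (simp add: program_embedding_def)
  moreover have "compose ?C \<mu> h x = compose ?C \<mu>' h x" if "x \<in> ?C - ?N" for x
  proof -
    have "h x \<notin> ?M"
      unfolding M using that N program_embedding_inj by (auto simp: inj_on_def)
    with that out program_embedding_carrier show ?thesis by (simp add: compose_def)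
  qed
  ultimately show ?thesis
    using val[OF \<mu>(1)] val[OF \<mu>(2)] by (simp add: global_step_def)
qed

text \<open>A step at \<open>h v\<close> touches only nodes in the image of \<open>h\<close>. Hence
  any extension of \<open>\<nu>\<close> can follow the step: it takes the new values on the image
  and keeps its own elsewhere.\<close>

lemma global_step_extend:
  assumes v: "v \<in> carrier (topo P)" "\<sigma> \<in> cmds S"
    and step: "(\<nu>, \<nu>') \<in> global_step S (topo P) (sem P) (carrier (topo P)) (\<sigma>, v)"
    and \<mu>: "\<mu> \<in> valuations S (carrier (topo Q))" "compose (carrier (topo P)) \<mu> h = \<nu>"
  shows "\<exists>\<mu>'. (\<mu>, \<mu>') \<in> global_step S (topo Q) (sem Q) (carrier (topo Q)) (\<sigma>, h v) \<and>
    \<mu>' \<in> valuations S (carrier (topo Q)) \<and> compose (carrier (topo P)) \<mu>' h = \<nu>'"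
proof -
  let ?C = "carrier (topo P)" and ?N = "Nd S (topo P) {v}" and ?M = "Nd S (topo Q) {h v}"
  note M = program_embedding_Nd[OF v(1)] and N = program_embedding_Nd_subset[OF v(1)]
  from step have \<nu>: "\<nu>' \<in> valuations S ?C"
    and s: "(restrict \<nu> ?N, restrict \<nu>' ?N) \<in> sem P \<sigma> v"
    and out: "\<forall>x \<in> ?C - ?N. \<nu> x = \<nu>' x"
    by (auto simp: global_step_def)
  define \<mu>' where "\<mu>' y = (if y \<in> h ` ?C then \<nu>' (inv_into ?C h y) else \<mu> y)" for y
  have \<mu>'_h: "\<mu>' (h x) = \<nu>' x" if "x \<in> ?C" for x
    using that program_embedding_inj by (simp add: \<mu>'_def)
  have \<mu>_h: "\<mu> (h x) = \<nu> x" if "x \<in> ?C" for x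
    using that \<mu>(2) by (auto simp: compose_def)
  have \<mu>'_val: "\<mu>' \<in> valuations S (carrier (topo Q))"
  proof (rule PiE_I)
    fix y assume "y \<in> carrier (topo Q)"
    then show "\<mu>' y \<in> carrier (data S)"
      using \<nu> \<mu>(1) \<mu>'_h by (cases "y \<in> h ` ?C") (auto simp: \<mu>'_def)
  next
    fix y assume "y \<notin> carrier (topo Q)"
    moreover from this have "y \<notin> h ` ?C" using program_embedding_carrier by auto
    ultimately show "\<mu>' y = undefined" using \<mu>(1) by (auto simp: \<mu>'_def PiE_def extensional_def)
  qed
  have comp: "compose ?C \<mu>' h = \<nu>'"
    using \<nu> \<mu>'_h by (auto simp: compose_def fun_eq_iff PiE_def extensional_def)
  \<comment> \<open>The pullback yields only some pair of valuations on \<open>?M\<close>; it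
    remains to identify it with the restrictions of \<open>\<mu>\<close> and
    \<open>\<mu>'\<close>.\<close>
  obtain a b where ab: "(a, b) \<in> sem Q \<sigma> (h v)"
    "restrict \<nu> ?N = compose ?N a h" "restrict \<nu>' ?N = compose ?N b h"
    using s PQ v by (auto simp: program_embedding_def pullback_def)
  have "sem Q \<sigma> (h v) \<subseteq> valuations S ?M \<times> valuations S ?M"
    using PQ v program_embedding_carrier[OF v(1)] unfolding program_embedding_def is_program_def
    by blast
  with ab(1) have ext: "a \<in> extensional ?M" "b \<in> extensional ?M" by (auto simp: PiE_def)
  \<comment> \<open>Since \<open>?M\<close> is the image of \<open>?N\<close>, an extensional
    function on \<open>?M\<close> is determined by its composition with \<open>h\<close>.\<close>
  have eq: "restrict \<xi> ?M = c"
    if "restrict \<zeta> ?N = compose ?N c h" "c \<in> extensional ?M" "\<And>x. x \<in> ?C \<Longrightarrow> \<xi> (h x) = \<zeta> x"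
    for \<xi> \<zeta> c
  proof
    fix y
    show "restrict \<xi> ?M y = c y"
    proof (cases "y \<in> ?M")
      case True
      then obtain x where x: "x \<in> ?N" "y = h x" unfolding M by blast
      then have "\<zeta> x = c (h x)" using fun_cong[OF that(1), of x] by (simp add: compose_def)
      with x True that(3)[of x] N show ?thesis by auto
    next
      case False
      with that(2) show ?thesis by (auto simp: extensional_def)
    qed
  qed
  have "(restrict \<mu> ?M, restrict \<mu>' ?M) \<in> sem Q \<sigma> (h v)"
    using ab(1) eq[OF ab(2) ext(1) \<mu>_h] eq[OF ab(3) ext(2) \<mu>'_h] by simp
  moreover have "\<mu> y = \<mu>' y" if "y \<in> carrier (topo Q) - ?M" for y
  proof (cases "y \<in> h ` ?C")
    case True
    then obtain x where "x \<in> ?C" "y = h x" by blast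
    moreover from this that have "x \<notin> ?N" unfolding M by blast
    ultimately show ?thesis using out \<mu>_h \<mu>'_h by simp
  qed (simp add: \<mu>'_def)
  ultimately have "(\<mu>, \<mu>') \<in> global_step S (topo Q) (sem Q) (carrier (topo Q)) (\<sigma>, h v)"
    using \<mu>(1) \<mu>'_val by (simp add: global_step_def)
  with \<mu>'_val comp show ?thesis by blast
qed

lemma global_restrict:
  assumes "(\<mu>, \<mu>') \<in> global S (topo Q) (sem Q) (carrier (topo Q)) (embed_run h \<rho>)"
    and "set \<rho> \<subseteq> cmds S \<times> carrier (topo P)"
  shows "(compose (carrier (topo P)) \<mu> h, compose (carrier (topo P)) \<mu>' h)
    \<in> global S (topo P) (sem P) (carrier (topo P)) \<rho>"
  using assms
proof (induction \<rho> arbitrary: \<mu>)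
  case Nil
  then show ?case using program_embedding_carrier by (auto simp: compose_def)
next
  case (Cons a \<rho>)
  then show ?case by (cases a) (auto dest: global_step_restrict)
qed

text \<open>The extension \<open>\<mu>\<close> stays arbitrary in the induction, because each step
  produces the extension from which the next one starts.\<close>

lemma global_extend:
  assumes "(\<nu>, \<nu>') \<in> global S (topo P) (sem P) (carrier (topo P)) \<rho>"
    and "set \<rho> \<subseteq> cmds S \<times> carrier (topo P)"
    and "\<mu> \<in> valuations S (carrier (topo Q))" and "compose (carrier (topo P)) \<mu> h = \<nu>"
  shows "\<exists>\<mu>'. (\<mu>, \<mu>') \<in> global S (topo Q) (sem Q) (carrier (topo Q)) (embed_run h \<rho>)"
  using assms
proof (induction \<rho> arbitrary: \<nu> \<mu>)
  case Nil
  then show ?case by auto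
next
  case (Cons a \<rho>)
  obtain \<sigma> v where a: "a = (\<sigma>, v)" by force
  from Cons.prems a obtain \<nu>1 where
    step: "(\<nu>, \<nu>1) \<in> global_step S (topo P) (sem P) (carrier (topo P)) (\<sigma>, v)"
    and rest: "(\<nu>1, \<nu>') \<in> global S (topo P) (sem P) (carrier (topo P)) \<rho>"
    and v: "v \<in> carrier (topo P)" "\<sigma> \<in> cmds S" and \<rho>: "set \<rho> \<subseteq> cmds S \<times> carrier (topo P)"
    by auto
  from global_step_extend[OF v step Cons.prems(3,4)] obtain \<mu>1 where
    \<mu>1: "(\<mu>, \<mu>1) \<in> global_step S (topo Q) (sem Q) (carrier (topo Q)) (\<sigma>, h v)"
    "\<mu>1 \<in> valuations S (carrier (topo Q))" "compose (carrier (topo P)) \<mu>1 h = \<nu>1"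
    by blast
  from Cons.IH[OF rest \<rho> \<mu>1(2,3)] \<mu>1(1) a show ?case by auto
qed

text \<open>Nonemptiness of the topology makes the data domain of a feasible run nonempty, so that
  valuations extend along the embedding.\<close>

lemma infeasible_embed_iff:
  assumes \<rho>: "set \<rho> \<subseteq> cmds S \<times> carrier (topo P)" and ne: "carrier (topo P) \<noteq> {}"
  shows "infeasible S Q (embed_run h \<rho>) \<longleftrightarrow> infeasible S P \<rho>"
proof
  assume P: "infeasible S P \<rho>"
  show "infeasible S Q (embed_run h \<rho>)"
    using global_restrict[OF _ \<rho>] P unfolding infeasible_def by fast
next
  assume Q: "infeasible S Q (embed_run h \<rho>)"
  show "infeasible S P \<rho>"
    unfolding infeasible_def
  proof (rule equals0I, clarify)
    fix \<nu> \<nu>' assume g: "(\<nu>, \<nu>') \<in> global S (topo P) (sem P) (carrier (topo P)) \<rho>"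
    let ?C = "carrier (topo P)"
    have \<nu>: "\<nu> \<in> valuations S ?C" by (rule global_domain[OF g])
    with ne obtain d where d: "d \<in> carrier (data S)" by (auto simp: PiE_def Pi_def)
    define \<mu> where "\<mu> = (\<lambda>y \<in> carrier (topo Q). if y \<in> h ` ?C then \<nu> (inv_into ?C h y) else d)"
    have "\<mu> \<in> valuations S (carrier (topo Q))"
      using d PiE_mem[OF \<nu>] by (auto simp: \<mu>_def program_embedding_inj)
    moreover have "compose ?C \<mu> h = \<nu>"
    proof
      fix x
      show "compose ?C \<mu> h x = \<nu> x"
      proof (cases "x \<in> ?C")
        case True
        then have "\<mu> (h x) = \<nu> (inv_into ?C h (h x))"
          unfolding \<mu>_def using program_embedding_carrier[OF True] by simp
        with True show ?thesis
          by (simp add: compose_def inv_into_f_f[OF program_embedding_inj])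
      next
        case False
        with PiE_arb[OF \<nu> False] show ?thesis by (simp add: compose_def)
      qed
    qed
    ultimately show False
      using global_extend[OF g \<rho>, of \<mu>] Q by (simp add: infeasible_def)
  qed
qed

end

section \<open>Limit programs\<close>

text \<open>\<open>compose X\<close> makes valuations undefined outside \<open>X\<close>; pairs in
  \<open>R\<close> survive unchanged because they are extensional on \<open>X\<close>.\<close>

lemma pullback_id:
  assumes "R \<subseteq> valuations S X \<times> valuations S X" and "\<And>x. x \<in> X \<Longrightarrow> h x = x"
  shows "pullback X h R = R"
proof -
  have "compose X \<nu> h = \<nu>" if "\<nu> \<in> valuations S X" for \<nu>
    using that assms(2) by (auto simp: compose_def fun_eq_iff PiE_def extensional_def)
  with assms(1) have "(\<lambda>(\<nu>, \<nu>'). (compose X \<nu> h, compose X \<nu>' h)) p = p" if "p \<in> R" for p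
    using that by (cases p) auto
  then show ?thesis unfolding pullback_def by (simp cong: image_cong)
qed

text \<open>The limit program is specified through local isomorphisms from the limit into members,
  opposite to \<open>h\<close>. Hence \<open>h\<close> is inverted on the substructure generated by
  \<open>v\<close>, and the resulting equation is pulled back along \<open>h\<close>, where the two
  maps cancel.\<close>

lemma member_embeds_in_limit:
  assumes P: "parameterized_program S I P" and L: "limit_program S I P PL" and i: "i \<in> I"
    and h: "embedding (node_voc S) (topo (P i)) (topo PL) h"
  shows "program_embedding S (P i) PL h"
proof -
  let ?A = "topo (P i)" and ?B = "topo PL"
  have prog: "is_program S (P i)" using P i by (simp add: parameterized_program_def)
  then have A: "structure_over (node_voc S) ?A" by (simp add: is_program_def)
  have "cmd_map PL (h v) = cmd_map (P i) v \<and>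
      (\<forall>\<sigma> \<in> cmds S. sem (P i) \<sigma> v = pullback (Nd S ?A {v}) h (sem PL \<sigma> (h v)))"
    if v: "v \<in> carrier ?A" for v
  proof -
    let ?N = "Nd S ?A {v}" and ?M = "Nd S ?B {h v}"
    \<comment> \<open>The shape in which \<open>local_iso_switch\<close>, applied to
      \<open>h\<close> and the identity, returns the inverse of \<open>h\<close>.\<close>
    let ?\<beta> = "id \<circ> inv_into ?N h"
    have "local_iso (node_voc S) ?A [v] ?B [h v] h"
      using embedding_imp_local_iso[OF A h, of "[v]"] v by simp
    moreover have "local_iso (node_voc S) ?A [v] ?A [v] id"
      using embedding_imp_local_iso[OF A embedding_id, of "[v]"] v by simp
    ultimately have iso: "local_iso (node_voc S) ?B [h v] ?A [v] ?\<beta>"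
      using local_iso_switch[of "node_voc S" ?A "[v]" ?B "[h v]" h ?A "[v]" id] by simp
    have hv: "h v \<in> carrier ?B" using h v by (auto simp: embedding_def)
    have lim: "cmd_map PL (h v) = cmd_map (P i) v"
      "\<forall>\<sigma> \<in> cmds S. sem PL \<sigma> (h v) = pullback ?M ?\<beta> (sem (P i) \<sigma> v)"
      using L i v hv iso unfolding limit_program_def by blast+
    have "inj_on h ?N"
      using h gen_subset_carrier[OF A, of "{v}"] v by (auto simp: embedding_def intro: inj_on_subset)
    then have inv: "?\<beta> (h x) = x" if "x \<in> ?N" for x using that by simp
    have img: "h ` ?N = ?M" using gen_image[OF A h, of "{v}"] v by simp
    have "sem (P i) \<sigma> v = pullback ?N h (sem PL \<sigma> (h v))" if "\<sigma> \<in> cmds S" for \<sigma>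
    proof -
      have "pullback ?N h (pullback ?M ?\<beta> (sem (P i) \<sigma> v)) = pullback ?N (\<lambda>x. x) (sem (P i) \<sigma> v)"
        using inv img by (intro pullback_pullback) auto
      also have "\<dots> = sem (P i) \<sigma> v"
        using prog v that by (intro pullback_id[where S = S]) (auto simp: is_program_def)
      finally show ?thesis using lim(2) that by simp
    qed
    with lim(1) show ?thesis by blast
  qed
  with A h L show ?thesis by (simp add: program_embedding_def limit_program_def)
qed

section \<open>Generated parts of the limit and the runs inside them\<close>

definition subprogram ::
  "('f, 'p, 'g, 'q, 'd, 'c, 'l) setting \<Rightarrow> ('f, 'p, 't, 'c, 'd) prog \<Rightarrow> 't set \<Rightarrow>
   ('f, 'p, 't, 'c, 'd) prog" where
  "subprogram S P X = P\<lparr>topo := gensub (node_voc S) (topo P) X\<rparr>"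

lemma subprogram_simps [simp]:
  "topo (subprogram S P X) = gensub (node_voc S) (topo P) X"
  "cmd_map (subprogram S P X) = cmd_map P" "sem (subprogram S P X) = sem P"
  by (simp_all add: subprogram_def)

text \<open>By \<open>gen_gensub\<close>, a node of the generated part generates the same
  substructure there as in the whole topology, so commands and relations can be kept
  verbatim.\<close>

lemma subprogram_embeds:
  assumes P: "is_program S P" and X: "X \<subseteq> carrier (topo P)"
  shows "program_embedding S (subprogram S P X) P id"
proof -
  have sub: "Nd S (topo P) X \<subseteq> carrier (topo P)"
    using P X by (intro gen_subset_carrier) (auto simp: is_program_def)
  have "sem P \<sigma> v = pullback (Nd S (topo P) {v}) id (sem P \<sigma> v)"
    if "v \<in> Nd S (topo P) X" "\<sigma> \<in> cmds S" for v \<sigma>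
  proof (rule pullback_id[where S = S, symmetric])
    have "v \<in> carrier (topo P)" using that(1) sub by blast
    with P that(2) show "sem P \<sigma> v \<subseteq>
        valuations S (Nd S (topo P) {v}) \<times> valuations S (Nd S (topo P) {v})"
      by (simp add: is_program_def)
  qed simp
  with P embedding_restrict[OF embedding_id sub] show ?thesis
    by (simp add: program_embedding_def gensub_simps structure_over_gensub)
qed

lemma local_iso_gensub:
  assumes "local_iso \<V> (gensub \<V> A X) as B bs \<beta>" and "gen \<V> A X \<subseteq> carrier A"
  shows "local_iso \<V> A as B bs \<beta>"
  using assms
  by (auto simp: local_iso_def isomorphism_def embedding_def gensub_simps in_lists_conv_set)

text \<open>Here \<open>g\<close> already runs from nodes of the limit to nodes of a member, the
  direction in which the limit program is specified, so its defining clause applies as it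
  stands.\<close>

lemma subprogram_of_limit_embeds_in_member:
  assumes P: "parameterized_program S I P" and L: "limit_program S I P PL" and i: "i \<in> I"
    and X: "X \<subseteq> carrier (topo PL)"
    and g: "embedding (node_voc S) (gensub (node_voc S) (topo PL) X) (topo (P i)) g"
  shows "program_embedding S (subprogram S PL X) (P i) g"
proof -
  let ?A = "gensub (node_voc S) (topo PL) X"
  have PL: "structure_over (node_voc S) (topo PL)"
    using L by (simp add: limit_program_def is_program_def)
  note sub = gen_subset_carrier[OF PL X]
  have "cmd_map (P i) (g v) = cmd_map PL v \<and>
      (\<forall>\<sigma> \<in> cmds S. sem PL \<sigma> v = pullback (Nd S (topo PL) {v}) g (sem (P i) \<sigma> (g v)))"
    if v: "v \<in> Nd S (topo PL) X" for v
  proof -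
    have "local_iso (node_voc S) ?A [v] (topo (P i)) [g v] g"
      using embedding_imp_local_iso[OF structure_over_gensub g, of "[v]"] v by (simp add: gensub_simps)
    then have "local_iso (node_voc S) (topo PL) [v] (topo (P i)) [g v] g"
      by (rule local_iso_gensub[OF _ sub])
    moreover have "v \<in> carrier (topo PL)" using v sub by blast
    moreover have "g v \<in> carrier (topo (P i))"
      using g v by (auto simp: embedding_def gensub_simps)
    ultimately have "cmd_map PL v = cmd_map (P i) (g v)"
      "\<forall>\<sigma> \<in> cmds S. sem PL \<sigma> v = pullback (Nd S (topo PL) {v}) g (sem (P i) \<sigma> (g v))"
      using L i unfolding limit_program_def by blast+
    then show ?thesis by simp
  qed
  with P i g show ?thesis
    by (simp add: program_embedding_def gensub_simps structure_over_gensub parameterized_program_def)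
qed

lemma embed_run_id [simp]: "embed_run id \<rho> = \<rho>"
  by (simp add: embed_run_def)

lemma embed_run_comp: "embed_run h (embed_run g \<rho>) = embed_run (h \<circ> g) \<rho>"
  by (auto simp: embed_run_def)

lemma error_run_set:
  assumes "is_program S P" and "\<rho> \<in> error_runs S P"
  shows "set \<rho> \<subseteq> cmds S \<times> carrier (topo P)" and "carrier (topo P) \<noteq> {}"
proof -
  obtain m where "loc_run S P (\<lambda>v \<in> carrier (topo P). l_init S) \<rho> m"
    using assms(2) by (auto simp: error_runs_def)
  then have "snd ` set \<rho> \<subseteq> carrier (topo P)" "fst ` set \<rho> \<subseteq> cmds S"
    using loc_run_nodes loc_run_cmds[OF assms(1)] by metis+
  then show "set \<rho> \<subseteq> cmds S \<times> carrier (topo P)" by fastforce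
  show "carrier (topo P) \<noteq> {}" using assms(2) by (auto simp: error_runs_def)
qed

text \<open>The bridge from the limit to the family. The run is recorded both in the generated part
  and in a member, since that part is the common domain through which infeasibility and triples are
  carried over.\<close>

lemma limit_error_run_in_member:
  assumes P: "parameterized_program S I P" and L: "limit_program S I P PL"
    and \<rho>: "\<rho> \<in> error_runs S PL"
  obtains X i g where "X \<subseteq> carrier (topo PL)" and "i \<in> I"
    and "embedding (node_voc S) (gensub (node_voc S) (topo PL) X) (topo (P i)) g"
    and "\<rho> \<in> error_runs S (subprogram S PL X)"
    and "embed_run g \<rho> \<in> error_runs S (P i)"
proof -
  have PL: "is_program S PL" using L by (simp add: limit_program_def)
  obtain m w where m: "loc_run S PL (\<lambda>v \<in> carrier (topo PL). l_init S) \<rho> m"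
    and w: "w \<in> carrier (topo PL)" "m w = l_err S"
    using \<rho> by (auto simp: error_runs_def image_iff)
  \<comment> \<open>\<open>w\<close> need not be scheduled: if the initial and error locations
    coincide, it may never move. Including it keeps the error visible in the generated part.\<close>
  define X where "X = insert w (snd ` set \<rho>)"
  have X: "finite X" "X \<subseteq> carrier (topo PL)"
    using loc_run_nodes[OF m] w(1) by (auto simp: X_def)
  then obtain i g where i: "i \<in> I"
    and g: "embedding (node_voc S) (gensub (node_voc S) (topo PL) X) (topo (P i)) g"
    using L unfolding limit_program_def is_limit_def by metis
  \<comment> \<open>Reflection along the inclusion of the generated part, with
    \<open>embed_run id\<close> being the identity.\<close>
  have "\<rho> \<in> error_runs S (subprogram S PL X)"
    using m w(2)
    by (intro error_runs_reflect[OF subprogram_embeds[OF PL X(2)], of \<rho> m w])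
      (auto simp: gensub_simps X_def intro: gen.base)
  moreover from this have "embed_run g \<rho> \<in> error_runs S (P i)"
    by (rule error_runs_embed[OF subprogram_of_limit_embeds_in_member[OF P L i X(2) g]])
  ultimately show ?thesis using that X(2) i g by blast
qed

lemma safe_family_iff_safe_limit:
  assumes P: "parameterized_program S I P" and L: "limit_program S I P PL"
  shows "safe_family S I P \<longleftrightarrow> safe S PL"
proof
  assume fam: "safe_family S I P"
  have PL: "is_program S PL" using L by (simp add: limit_program_def)
  show "safe S PL"
    unfolding safe_def
  proof
    fix \<rho> assume \<rho>: "\<rho> \<in> error_runs S PL"
    obtain X i g where X: "X \<subseteq> carrier (topo PL)" and i: "i \<in> I"
      and g: "embedding (node_voc S) (gensub (node_voc S) (topo PL) X) (topo (P i)) g"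
      and sub: "\<rho> \<in> error_runs S (subprogram S PL X)"
      and run: "embed_run g \<rho> \<in> error_runs S (P i)"
      by (rule limit_error_run_in_member[OF P L \<rho>])
    let ?R = "subprogram S PL X"
    obtain m where "loc_run S ?R (\<lambda>v \<in> carrier (topo ?R). l_init S) \<rho> m"
      and ne: "carrier (topo ?R) \<noteq> {}"
      using sub by (auto simp: error_runs_def)
    then have "snd ` set \<rho> \<subseteq> carrier (topo ?R)" by (blast dest: loc_run_nodes)
    with error_run_set(1)[OF PL \<rho>] have set: "set \<rho> \<subseteq> cmds S \<times> carrier (topo ?R)" by fastforce
    have "infeasible S (P i) (embed_run g \<rho>)"
      using fam i run by (simp add: safe_family_def safe_def)
    \<comment> \<open>Infeasibility passes from the member to the generated part and from there to
      the limit, as the limit itself has in general no embedding into the member.\<close>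
    then have "infeasible S ?R \<rho>"
      using infeasible_embed_iff[OF subprogram_of_limit_embeds_in_member[OF P L i X g] set ne] by simp
    then show "infeasible S PL \<rho>"
      using infeasible_embed_iff[OF subprogram_embeds[OF PL X] set ne] by simp
  qed
next
  assume lim: "safe S PL"
  show "safe_family S I P"
    unfolding safe_family_def safe_def
  proof (intro ballI)
    fix i \<rho> assume i: "i \<in> I" and \<rho>: "\<rho> \<in> error_runs S (P i)"
    \<comment> \<open>Conversely a whole member embeds into the limit, so a single transfer
      suffices.\<close>
    obtain h where "embedding (node_voc S) (topo (P i)) (topo PL) h"
      using L i by (auto simp: limit_program_def is_limit_def)
    note h = member_embeds_in_limit[OF P L i this]
    have "is_program S (P i)" using P i by (simp add: parameterized_program_def)
    note set = error_run_set[OF this \<rho>]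
    have "infeasible S PL (embed_run h \<rho>)"
      using lim error_runs_embed[OF h \<rho>] by (simp add: safe_def)
    then show "infeasible S (P i) \<rho>"
      using infeasible_embed_iff[OF h set] by simp
  qed
qed

section \<open>Proof spaces\<close>

text \<open>\<open>A\<close> is the common domain of the two placements: passing from
  \<open>g\<close> to \<open>h\<close> on the tuple of scheduled nodes gives a local isomorphism
  within \<open>T\<close>, as S-param requires.\<close>

lemma lang_embed_transfer:
  fixes A :: "('f, 'p, 'a) struct" and T :: "('f, 'p, 'u) struct"
  assumes H: "proof_space S T H" and A: "structure_over (node_voc S) A"
    and g: "embedding (node_voc S) A T g" and h: "embedding (node_voc S) A T h"
    and \<rho>: "snd ` set \<rho> \<subseteq> carrier A" and run: "embed_run g \<rho> \<in> lang H"
  shows "embed_run h \<rho> \<in> lang H"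
proof -
  let ?vs = "map snd \<rho>" and ?\<sigma>s = "map fst \<rho>"
  have vs: "set ?vs \<subseteq> carrier A" using \<rho> by simp
  have "local_iso (node_voc S) T (map g ?vs) T (map h ?vs)
      (h \<circ> inv_into (gen (node_voc S) A (set ?vs)) g)"
    by (rule local_iso_switch[OF embedding_imp_local_iso[OF A g vs] embedding_imp_local_iso[OF A h vs]])
  then have iso: "locally_isomorphic (node_voc S) T ([] @ map g ?vs @ []) T ([] @ map h ?vs @ [])"
    unfolding locally_isomorphic_def by auto
  have zip: "embed_run k \<rho> = zip ?\<sigma>s (map k ?vs)" for k :: "'a \<Rightarrow> 'u"
    by (induction \<rho>) (auto simp: embed_run_def)
  have "(inst Top [], zip ?\<sigma>s (map g ?vs), inst Bot []) \<in> H"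
    using run by (simp add: lang_def inst_def zip)
  \<comment> \<open>\<open>Top\<close> and \<open>Bot\<close> have no parameters, so the pre- and
    postcondition tuples are empty; only the scheduled nodes, in order and with repetitions, have to
    match.\<close>
  moreover have "s_param_closed S T H" using H by (simp add: proof_space_def)
  note this[unfolded s_param_closed_def, rule_format,
      of "[]" Top "[]" Bot ?\<sigma>s "map g ?vs" "[]" "map h ?vs" "[]"]
  ultimately have "(inst Top [], zip ?\<sigma>s (map h ?vs), inst Bot []) \<in> H"
    using iso by (simp add: data_formula_def)
  then show ?thesis by (simp add: lang_def inst_def zip)
qed

text \<open>Validity of \<open>H\<close> is common to both sides, so only the inclusions into
  \<open>lang H\<close> are compared. The embeddings into \<open>T\<close> need not be compatible
  with each other; \<open>lang_embed_transfer\<close> absorbs the mismatch.\<close>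

lemma proves_family_iff_proves_limit:
  assumes P: "parameterized_program S I P" and L: "limit_program S I P PL"
    and T: "universal_structure (node_voc S) I (\<lambda>i. topo (P i)) T e"
    and eL: "embedding (node_voc S) (topo PL) T eL" and H: "proof_space S T H"
  shows "proves_family S I P T e H \<longleftrightarrow> proves_limit S I P T PL eL H"
proof -
  have e: "embedding (node_voc S) (topo (P i)) T (e i)" if "i \<in> I" for i
    using T that by (simp add: universal_structure_def)
  have "embed_run eL \<rho> \<in> lang H"
    if fam: "\<And>i \<rho>. i \<in> I \<Longrightarrow> \<rho> \<in> error_runs S (P i) \<Longrightarrow> embed_run (e i) \<rho> \<in> lang H"
      and \<rho>: "\<rho> \<in> error_runs S PL" for \<rho>
  proof -
    obtain X i g where X: "X \<subseteq> carrier (topo PL)" and i: "i \<in> I"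
      and g: "embedding (node_voc S) (gensub (node_voc S) (topo PL) X) (topo (P i)) g"
      and sub: "\<rho> \<in> error_runs S (subprogram S PL X)"
      and run: "embed_run g \<rho> \<in> error_runs S (P i)"
      by (rule limit_error_run_in_member[OF P L \<rho>])
    have "structure_over (node_voc S) (topo PL)"
      using L by (simp add: limit_program_def is_program_def)
    then have res: "embedding (node_voc S) (gensub (node_voc S) (topo PL) X) T eL"
      by (intro embedding_restrict[OF eL] gen_subset_carrier X)
    have "snd ` set \<rho> \<subseteq> carrier (gensub (node_voc S) (topo PL) X)"
      using sub loc_run_nodes by (fastforce simp: error_runs_def)
    \<comment> \<open>The generated part now has two placements in \<open>T\<close>: directly by
      \<open>eL\<close>, and through the member by \<open>e i \<circ> g\<close>.\<close>
    moreover have "embed_run (e i \<circ> g) \<rho> \<in> lang H"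
      using fam[OF i run] by (simp add: embed_run_comp)
    ultimately show ?thesis
      by (intro lang_embed_transfer[OF H structure_over_gensub embedding_comp[OF g e[OF i]] res])
  qed
  moreover have "embed_run (e i) \<rho> \<in> lang H"
    if lim: "\<And>\<rho>. \<rho> \<in> error_runs S PL \<Longrightarrow> embed_run eL \<rho> \<in> lang H"
      and i: "i \<in> I" and \<rho>: "\<rho> \<in> error_runs S (P i)" for i \<rho>
  proof -
    obtain h where h: "embedding (node_voc S) (topo (P i)) (topo PL) h"
      using L i by (auto simp: limit_program_def is_limit_def)
    have prog: "is_program S (P i)" using P i by (simp add: parameterized_program_def)
    have "snd ` set \<rho> \<subseteq> carrier (topo (P i))" using error_run_set(1)[OF prog \<rho>] by auto
    \<comment> \<open>Both \<open>eL \<circ> h\<close> and \<open>e i\<close> embed the member,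
      possibly at different places of \<open>T\<close>.\<close>
    moreover have "embed_run (eL \<circ> h) \<rho> \<in> lang H"
      using lim[OF error_runs_embed[OF member_embeds_in_limit[OF P L i h] \<rho>]]
      by (simp add: embed_run_comp)
    moreover have "structure_over (node_voc S) (topo (P i))" using prog by (simp add: is_program_def)
    ultimately show ?thesis
      by (intro lang_embed_transfer[OF H _ embedding_comp[OF h eL] e[OF i]])
  qed
  ultimately show ?thesis
    unfolding proves_family_def proves_limit_def UN_subset_iff image_subset_iff by metis
qed

theorem theorem7p4:
  fixes S :: "('f, 'p, 'g, 'q, 'd, 'c, 'l) setting"
    and I :: "'i set"
    and P :: "'i \<Rightarrow> ('f, 'p, 't, 'c, 'd) prog"
    and PL :: "('f, 'p, 's, 'c, 'd) prog"
  assumes "wf_setting S"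
    and "parameterized_program S I P"
    and "limit_program S I P PL"
  shows "(safe_family S I P \<longleftrightarrow> safe S PL) \<and>
    (\<forall>(T :: ('f, 'p, 'u) struct) e eL H.
       universal_structure (node_voc S) I (\<lambda>i. topo (P i)) T e \<and>
       embedding (node_voc S) (topo PL) T eL \<and>
       proof_space S T H \<longrightarrow>
       (proves_family S I P T e H \<longleftrightarrow> proves_limit S I P T PL eL H))"
  by (intro conjI allI impI safe_family_iff_safe_limit[OF assms(2,3)]
      proves_family_iff_proves_limit[OF assms(2,3)]) simp_all

end
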